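(* Let $n\ge2$, $B=M_n(\mathbb{C})$, and let $h_0$ be (the density of) a marginal tracial state on $B\otimes B$, with range projection $R(h_0)$. Then the following conditions are equivalent: (i) $h_0$ is extremal among the marginal tracial states on $B\otimes B$ (i.e. an extreme point of the convex set of all marginal tracial states); (ii) $R(h_0)(B\otimes B)R(h_0)\cap V=\{0\}$; (iii) $R(h_0)(B\otimes B)R(h_0)\cap\{\lambda I+v:\lambda\in\mathbb{C},\ v\in V\}=\{\lambda h_0:\lambda\in\mathbb{C}\}$.
   Context: $\tau$ denotes the unique tracial state (normalized trace, $\tau(I)=1$) on $B\otimes B\cong M_{n^2}(\mathbb{C})$, and $\tau_B$ the normalized trace on $B$. States on $B\otimes B$ are identified with positive elements $h\in B\otimes B$ with $\tau(h)=1$ via $\phi(a)=\tau(ah)$. A state $\phi$ is a marginal tracial state if $\phi(x\otimes I)=\phi(I\otimes x)=\tau_B(x)$ for all $x\in B$. $P$ (resp. $Q$) is the canonical trace-preserving conditional expectation of $B\otimes B$ onto $B\otimes I$ (resp. $I\otimes B$), i.e. the linear map with $P(x\otimes y)=\tau_B(y)\,x\otimes I$ (resp. $Q(x\otimes y)=\tau_B(x)\,I\otimes y$). $V=\ker(P+Q)$; equivalently $V=N\otimes N$, where $N=\{b\in B:\tau_B(b)=0\}$. The range projection $R(h_0)$ is the orthogonal projection in $B\otimes B$ onto the range of $h_0$. *)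

theory Defs
  imports "HOL-Analysis.Analysis"
begin

text \<open>
  The algebra B of n by n complex matrices is the type \<^typ>\<open>complex^'n^'n\<close> with
  n = \<^term>\<open>CARD('n)\<close>.  Its tensor square is realised, through the Kronecker product, as the full
  matrix algebra with row and column index type \<^typ>\<open>'n \<times> 'n\<close>.
\<close>

type_synonym 'n cmat = "complex^'n^'n"

type_synonym 'n cmat2 = "complex^('n \<times> 'n)^('n \<times> 'n)"

definition cscale :: "complex \<Rightarrow> 'n::finite cmat \<Rightarrow> 'n cmat" where
  "cscale c A = (\<chi> i j. c * A $ i $ j)"

definition ctranspose :: "'n::finite cmat \<Rightarrow> 'n cmat" where
  "ctranspose A = (\<chi> i j. cnj (A $ j $ i))"

definition cinner :: "complex^'n::finite \<Rightarrow> complex^'n \<Rightarrow> complex" where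
  "cinner x y = (\<Sum>i\<in>UNIV. cnj (x $ i) * y $ i)"

definition positive_matrix :: "'n::finite cmat \<Rightarrow> bool" where
  "positive_matrix A \<longleftrightarrow> ctranspose A = A \<and> (\<forall>x. 0 \<le> Re (cinner x (A *v x)))"

definition ntrace :: "'n::finite cmat \<Rightarrow> complex" where
  "ntrace A = trace A / of_nat CARD('n)"

definition tensor :: "'n::finite cmat \<Rightarrow> 'n cmat \<Rightarrow> 'n cmat2" where
  "tensor A B = (\<chi> p q. A $ fst p $ fst q * B $ snd p $ snd q)"

definition state_density :: "'n::finite cmat2 \<Rightarrow> bool" where
  "state_density h \<longleftrightarrow> positive_matrix h \<and> ntrace h = 1"

text \<open>The state with density \<open>h\<close> is \<open>a \<mapsto> ntrace (a ** h)\<close>.\<close>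

definition marginal_tracial :: "'n::finite cmat2 \<Rightarrow> bool" where
  "marginal_tracial h \<longleftrightarrow> state_density h \<and>
     (\<forall>x. ntrace (tensor x (mat 1) ** h) = ntrace x \<and>
          ntrace (tensor (mat 1) x ** h) = ntrace x)"

text \<open>
  The conditional expectations onto the two tensor factors are normalised partial traces
  tensored with the identity; the lemmas below show that they are the linear maps
  prescribed on elementary tensors by \<open>x \<otimes> y \<mapsto> \<tau>(y) (x \<otimes> I)\<close> and
  \<open>x \<otimes> y \<mapsto> \<tau>(x) (I \<otimes> y)\<close>.
\<close>

definition cond_exp1 :: "'n::finite cmat2 \<Rightarrow> 'n cmat2" where
  "cond_exp1 a =
     tensor (\<chi> i k. (\<Sum>j\<in>UNIV. a $ (i, j) $ (k, j)) / of_nat CARD('n)) (mat 1)"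

definition cond_exp2 :: "'n::finite cmat2 \<Rightarrow> 'n cmat2" where
  "cond_exp2 a =
     tensor (mat 1) (\<chi> j l. (\<Sum>i\<in>UNIV. a $ (i, j) $ (i, l)) / of_nat CARD('n))"

lemma cond_exp1_tensor: "cond_exp1 (tensor x y) = cscale (ntrace y) (tensor x (mat 1))"
  by (simp add: cond_exp1_def tensor_def cscale_def ntrace_def trace_def vec_eq_iff
      sum_distrib_left[symmetric] mult_ac)

lemma cond_exp2_tensor: "cond_exp2 (tensor x y) = cscale (ntrace x) (tensor (mat 1) y)"
  by (simp add: cond_exp2_def tensor_def cscale_def ntrace_def trace_def vec_eq_iff
      sum_distrib_right[symmetric] mult_ac)

lemma cond_exp_add:
  "cond_exp1 (a + b) = cond_exp1 a + cond_exp1 b"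
  "cond_exp2 (a + b) = cond_exp2 a + cond_exp2 b"
  by (simp_all add: cond_exp1_def cond_exp2_def tensor_def vec_eq_iff sum.distrib
      add_divide_distrib algebra_simps)

lemma cond_exp_cscale:
  "cond_exp1 (cscale c a) = cscale c (cond_exp1 a)"
  "cond_exp2 (cscale c a) = cscale c (cond_exp2 a)"
  by (simp_all add: cond_exp1_def cond_exp2_def tensor_def cscale_def vec_eq_iff
      sum_distrib_left[symmetric] mult_ac)

definition V_space :: "'n::finite cmat2 set" where
  "V_space = {a. cond_exp1 a + cond_exp2 a = 0}"

text \<open>An orthogonal projection is a self-adjoint idempotent.\<close>

definition is_range_projection :: "'n::finite cmat \<Rightarrow> 'n cmat \<Rightarrow> bool" where
  "is_range_projection h p \<longleftrightarrow>
     p ** p = p \<and> ctranspose p = p \<and> range (\<lambda>x. p *v x) = range (\<lambda>x. h *v x)"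

definition range_projection :: "'n::finite cmat \<Rightarrow> 'n cmat" where
  "range_projection h = (THE p. is_range_projection h p)"

lemma inner_cinner: "x \<bullet> y = Re (cinner x y)" for x y :: "complex^'n::finite"
  by (simp add: cinner_def inner_vec_def inner_complex_def)

lemma cinner_ctranspose: "cinner (ctranspose A *v x) y = cinner x (A *v y)"
  apply (simp add: cinner_def ctranspose_def matrix_vector_mult_def sum_distrib_left
      sum_distrib_right)
  apply (subst sum.swap)
  apply (simp add: mult_ac)
  done

lemma inner_ctranspose: "(ctranspose A *v x) \<bullet> y = x \<bullet> (A *v y)"
  by (simp add: inner_cinner cinner_ctranspose)

lemma inner_cnj_scale: "(c *s x) \<bullet> y = x \<bullet> (cnj c *s y)" for x y :: "complex^'n::finite"
  by (simp add: inner_cinner cinner_def mult_ac)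

lemma is_range_projection_unique:
  assumes "is_range_projection h p" "is_range_projection h q"
  shows "p = q"
proof -
  have 1: "a ** b = b" if "is_range_projection h a" "is_range_projection h b" for a b
  proof -
    have "a *v (b *v x) = b *v x" for x
    proof -
      have "b *v x \<in> range (\<lambda>x. a *v x)"
        using that by (auto simp: is_range_projection_def)
      then obtain y where "b *v x = a *v y" by auto
      then show ?thesis
        using that by (simp add: is_range_projection_def matrix_vector_mul_assoc)
    qed
    then show ?thesis
      by (simp add: matrix_eq matrix_vector_mul_assoc)
  qed
  have ct: "ctranspose (a ** b) = ctranspose b ** ctranspose a" for a b :: "'a cmat"
    by (simp add: ctranspose_def matrix_matrix_mult_def vec_eq_iff mult_ac)
  have "p = ctranspose p" using assms by (simp add: is_range_projection_def)
  also have "\<dots> = ctranspose (q ** p)" using 1 assms by simp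
  also have "\<dots> = p ** q" using assms by (simp add: ct is_range_projection_def)
  also have "\<dots> = q" using 1 assms by simp
  finally show ?thesis .
qed

lemma is_range_projection_exists: "\<exists>p. is_range_projection h p"
proof -
  define S where "S = range (\<lambda>x. h *v x)"
  have S_add: "x + y \<in> S" if "x \<in> S" "y \<in> S" for x y
    using that unfolding S_def by (auto simp flip: matrix_vector_right_distrib)
  have S_scale: "c *s x \<in> S" if "x \<in> S" for c x
    using that unfolding S_def by (auto simp flip: vector_scalar_commute)
  have scaleR: "r *\<^sub>R x = complex_of_real r *s x" for r and x :: "complex^'a"
    by (simp add: vec_eq_iff complex_eq_iff)
  have S_0: "0 \<in> S" unfolding S_def by (metis matrix_vector_mult_0_right rangeI)
  have subS: "subspace S"
    by (simp add: subspace_def S_0 S_add S_scale scaleR)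
  have "\<exists>y. y \<in> S \<and> (\<forall>w\<in>S. (x - y) \<bullet> w = 0)" for x
  proof -
    obtain y z where "y \<in> span S" "\<And>w. w \<in> span S \<Longrightarrow> orthogonal z w" "x = y + z"
      using orthogonal_subspace_decomp_exists by blast
    then show ?thesis
      using span_eq_iff[THEN iffD2, OF subS] by (intro exI[of _ y]) (auto simp: orthogonal_def)
  qed
  then obtain f where fS: "\<And>x. f x \<in> S" and fo: "\<And>x w. w \<in> S \<Longrightarrow> (x - f x) \<bullet> w = 0"
    by metis
  have fu: "f x = y" if "y \<in> S" "\<And>w. w \<in> S \<Longrightarrow> (x - y) \<bullet> w = 0" for x y
  proof -
    have d: "f x - y \<in> S" using subS fS that(1) by (simp add: subspace_diff)
    have "(f x - y) \<bullet> (f x - y) = (x - y) \<bullet> (f x - y) - (x - f x) \<bullet> (f x - y)"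
      by (simp add: inner_diff_left)
    also have "\<dots> = 0" using that(2) fo d by simp
    finally show ?thesis by simp
  qed
  have f_add: "f (x + y) = f x + f y" for x y
  proof (rule fu)
    show "f x + f y \<in> S" by (simp add: S_add fS)
    show "(x + y - (f x + f y)) \<bullet> w = 0" if "w \<in> S" for w
      using fo[OF that, of x] fo[OF that, of y] by (simp add: inner_simps)
  qed
  have f_scale: "f (c *s x) = c *s f x" for c x
  proof (rule fu)
    show "c *s f x \<in> S" by (simp add: S_scale fS)
    show "(c *s x - c *s f x) \<bullet> w = 0" if "w \<in> S" for w
      using fo[OF S_scale[OF that]] 
      by (metis inner_cnj_scale vec.scale_right_diff_distrib)
  qed
  have lin: "Vector_Spaces.linear (*s) (*s) f"
    by unfold_locales (simp_all add: f_add f_scale)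
  define p where "p = matrix f"
  have pf: "p *v x = f x" for x unfolding p_def by (rule matrix_works[OF lin])
  have fid: "f x = x" if "x \<in> S" for x using that by (intro fu) auto
  have "p ** p = p"
    by (simp add: matrix_eq pf fid fS flip: matrix_vector_mul_assoc)
  moreover have "ctranspose p = p"
  proof -
    have "x \<bullet> f y = f x \<bullet> y" for x y
      using fo[OF fS, of x y] fo[OF fS, of y x] by (simp add: inner_simps inner_commute)
    then have "(ctranspose p *v x) \<bullet> y = (p *v x) \<bullet> y" for x y
      by (simp add: inner_ctranspose pf)
    then show ?thesis
      by (metis matrix_eq vector_eq_rdot)
  qed
  moreover have "range (\<lambda>x. p *v x) = S"
    using fid fS by (auto simp: pf) (metis rangeI)
  ultimately show ?thesis
    unfolding is_range_projection_def S_def by blast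
qed

lemma is_range_projection_range_projection: "is_range_projection h (range_projection h)"
  unfolding range_projection_def
  by (metis theI is_range_projection_exists is_range_projection_unique)

definition corner :: "'n::finite cmat \<Rightarrow> 'n cmat set" where
  "corner p = {p ** a ** p | a. True}"

end

theory Submission
  imports Defs
begin

text \<open>
  Fix a marginal tracial density \<open>h\<close> and let \<open>p\<close> be its range projection. Two facts drive
  the proof.

  First, the marginal tracial densities are exactly the positive matrices in the affine space
  \<open>I + V\<close> (\<open>marginal_tracial_iff\<close>). Having normalised traces as marginals means that both
  partial traces are the identity, because the trace form is nondegenerate; and \<open>V\<close> consists of
  the matrices whose two partial traces both vanish, because \<open>x \<otimes> I + I \<otimes> y = 0\<close> with
  \<open>x\<close> and \<open>y\<close> of equal trace forces \<open>x = y = 0\<close>.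

  Second, the self-adjoint elements of the corner \<open>p M p\<close> are precisely the directions in which
  \<open>h\<close> can be moved both ways without losing positivity. If \<open>v\<close> is self-adjoint in the corner
  then \<open>h \<plusminus> e v\<close> is positive for small \<open>e > 0\<close> (\<open>positive_matrix_perturb\<close>); conversely, if \<open>h\<close> is a proper convex combination of
  positive matrices, then each of them vanishes on the kernel of \<open>h\<close>, hence lies in the corner
  (\<open>positive_matrix_mult_zero_mono\<close>, \<open>corner_if_mult_zero\<close>). Both directions avoid the spectral
  theorem: they rest on the single estimate \<open>|h x|\<^sup>2 \<le> C (x \<bullet> h x)\<close>, valid for every positive
  matrix (\<open>positive_matrix_square_bound\<close>), which replaces a lower bound on the nonzero eigenvalues.

  So a nonzero element of the corner in \<open>V\<close> gives, through its real or imaginary part, a segment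
  of marginal tracial densities with midpoint \<open>h\<close>, and the difference of the end points of a
  segment of such densities with \<open>h\<close> in its interior is a nonzero element of the corner in \<open>V\<close>. This is the equivalence of
  extremality with triviality of the intersection. The second equivalence is linear algebra: since
  \<open>h\<close> lies in \<open>I + V\<close> and in the corner, subtracting \<open>\<lambda> h\<close> carries elements of the corner of the
  form \<open>\<lambda> I + v\<close> to elements of the corner in \<open>V\<close>; and \<open>h\<close> itself is not in \<open>V\<close>, as
  \<open>I\<close> is not.
\<close>

section \<open>Complex scaling and adjoints\<close>

lemma ctranspose_mult: "ctranspose (a ** b) = ctranspose b ** ctranspose a"
  by (simp add: ctranspose_def matrix_matrix_mult_def vec_eq_iff mult_ac)

lemma ctranspose_ctranspose [simp]: "ctranspose (ctranspose a) = a"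
  by (simp add: ctranspose_def vec_eq_iff)

lemma ctranspose_add: "ctranspose (a + b) = ctranspose a + ctranspose b"
  by (simp add: ctranspose_def vec_eq_iff)

lemma ctranspose_cscale: "ctranspose (cscale c a) = cscale (cnj c) (ctranspose a)"
  by (simp add: ctranspose_def cscale_def vec_eq_iff)

lemma scaleR_eq_cscale: "r *\<^sub>R a = cscale (of_real r) a"
  by (simp add: cscale_def vec_eq_iff) (simp add: scaleR_conv_of_real)

lemma diff_eq_add_cscale: "a - b = a + cscale (- 1) b"
  by (simp add: cscale_def vec_eq_iff)

lemma cscale_mult_left: "cscale c a ** b = cscale c (a ** b)"
  by (simp add: cscale_def matrix_matrix_mult_def vec_eq_iff sum_distrib_left mult_ac)

lemma cscale_mult_right: "a ** cscale c b = cscale c (a ** b)"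
  by (simp add: cscale_def matrix_matrix_mult_def vec_eq_iff sum_distrib_left mult_ac)

lemma scaleR_mult_vector: "(r *\<^sub>R a) *v x = r *\<^sub>R (a *v x)"
  for a :: "'n::finite cmat"
  by (simp add: matrix_vector_mult_def vec_eq_iff scaleR_sum_right)

text \<open>
  The real inner product is the real part of the complex one, so positivity can be handled
  entirely with the real inner product space structure on complex vectors.
\<close>

lemma positive_matrix_iff:
  "positive_matrix a \<longleftrightarrow> ctranspose a = a \<and> (\<forall>x. 0 \<le> x \<bullet> (a *v x))"
  by (simp add: positive_matrix_def inner_cinner)

section \<open>Positive matrices and their kernels\<close>

lemma operator_bound:
  fixes a :: "'n::finite cmat"
  obtains K where "K > 0" "\<And>x. norm (a *v x) \<le> norm x * K"
  using bounded_linear.pos_bounded[OF matrix_vector_mul_bounded_linear[of a]] by blast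

text \<open>
  Positivity of the quadratic form at \<open>x - t (h x)\<close>, with \<open>t\<close> the inverse of an operator norm
  bound for \<open>h\<close>, gives the estimate. It says that \<open>x \<bullet> h x\<close> controls the full size of \<open>h x\<close>,
  which yields both that \<open>x \<bullet> h x = 0\<close> implies \<open>h x = 0\<close> and that \<open>h\<close> absorbs small
  perturbations supported on its range.
\<close>

lemma positive_matrix_square_bound:
  assumes "positive_matrix h"
  obtains C where "C > 0" "\<And>x. (norm (h *v x))\<^sup>2 \<le> C * (x \<bullet> (h *v x))"
proof -
  obtain K where K: "K > 0" "\<And>x. norm (h *v x) \<le> norm x * K"
    using operator_bound by blast
  have "(norm (h *v x))\<^sup>2 \<le> K * (x \<bullet> (h *v x))" for x
  proof -
    define y where "y = h *v x"
    have sym: "x \<bullet> (h *v y) = y \<bullet> y"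
      using assms inner_ctranspose[of h x y] by (simp add: positive_matrix_iff y_def)
    have "y \<bullet> (h *v y) \<le> norm y * norm (h *v y)"
      by (rule norm_cauchy_schwarz)
    also have "\<dots> \<le> norm y * (norm y * K)"
      using K by (intro mult_left_mono) auto
    also have "\<dots> = K * (y \<bullet> y)"
      by (simp add: dot_square_norm power2_eq_square)
    finally have yy: "y \<bullet> (h *v y) \<le> K * (y \<bullet> y)" .
    define t where "t = 1 / K"
    have "0 \<le> (x - t *\<^sub>R y) \<bullet> (h *v (x - t *\<^sub>R y))"
      using assms by (simp add: positive_matrix_iff)
    also have "h *v (x - t *\<^sub>R y) = y - t *\<^sub>R (h *v y)"
      by (simp add: linear_diff linear_scale y_def)
    also have "(x - t *\<^sub>R y) \<bullet> (y - t *\<^sub>R (h *v y))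
        = x \<bullet> y - 2 * t * (y \<bullet> y) + t * t * (y \<bullet> (h *v y))"
      by (simp add: inner_simps sym algebra_simps)
    also have "\<dots> \<le> x \<bullet> y - 2 * t * (y \<bullet> y) + t * t * (K * (y \<bullet> y))"
      using yy by (intro add_left_mono mult_left_mono) auto
    also have "\<dots> = x \<bullet> y - (y \<bullet> y) / K"
      using K by (simp add: t_def field_simps)
    finally show ?thesis
      using K by (simp add: dot_square_norm field_simps flip: y_def)
  qed
  with K that show thesis by blast
qed

text \<open>
  On the kernel of \<open>h\<close> the nonnegative quadratic forms of the summands add up to zero, so each
  of them vanishes there, and a positive matrix kills the zeros of its quadratic form.
\<close>

lemma positive_matrix_mult_zero_mono:
  assumes "positive_matrix a" "positive_matrix b" "0 < s" "0 \<le> t"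
    and h: "h = s *\<^sub>R a + t *\<^sub>R b" and "h *v x = 0"
  shows "a *v x = 0"
proof -
  obtain C where C: "C > 0" "\<And>x. (norm (a *v x))\<^sup>2 \<le> C * (x \<bullet> (a *v x))"
    using positive_matrix_square_bound[OF assms(1)] by blast
  have "s * (x \<bullet> (a *v x)) + t * (x \<bullet> (b *v x)) = x \<bullet> (h *v x)"
    by (simp add: h matrix_vector_mult_add_rdistrib scaleR_mult_vector inner_simps)
  then have "s * (x \<bullet> (a *v x)) + t * (x \<bullet> (b *v x)) = 0"
    using \<open>h *v x = 0\<close> by simp
  moreover have "0 \<le> t * (x \<bullet> (b *v x))" "0 \<le> x \<bullet> (a *v x)"
    using assms by (auto simp: positive_matrix_iff)
  ultimately have "s * (x \<bullet> (a *v x)) \<le> 0" by linarith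
  then have "x \<bullet> (a *v x) = 0"
    using \<open>0 < s\<close> \<open>0 \<le> x \<bullet> (a *v x)\<close> by (simp add: mult_le_0_iff)
  then show ?thesis using C(2)[of x] by simp
qed

section \<open>The corner cut out by a range projection\<close>

lemma range_projection_idem: "range_projection h ** range_projection h = range_projection h"
  and ctranspose_range_projection: "ctranspose (range_projection h) = range_projection h"
  and range_range_projection:
    "range (\<lambda>x. range_projection h *v x) = range (\<lambda>x. h *v x)"
  using is_range_projection_range_projection[of h] by (auto simp: is_range_projection_def)

lemma range_projection_mult: "range_projection h ** h = h"
proof -
  have "range_projection h *v (h *v x) = h *v x" for x
  proof -
    have "h *v x \<in> range (\<lambda>x. range_projection h *v x)"
      by (simp add: range_range_projection)
    then obtain y where "h *v x = range_projection h *v y" by auto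
    then show ?thesis by (simp add: matrix_vector_mul_assoc range_projection_idem)
  qed
  then show ?thesis by (simp add: matrix_eq matrix_vector_mul_assoc)
qed

lemma mult_range_projection:
  assumes "ctranspose h = h"
  shows "h ** range_projection h = h"
  using arg_cong[OF range_projection_mult[of h], of ctranspose] assms
  by (simp add: ctranspose_mult ctranspose_range_projection)

text \<open>
  Each column of the projection lies in the range of \<open>h\<close>; the columns of the second factor are
  preimages.
\<close>

lemma range_projection_factor:
  obtains k where "range_projection h = h ** k"
proof -
  have "\<exists>y. range_projection h *v axis i 1 = h *v y" for i
  proof -
    have "range_projection h *v axis i 1 \<in> range (\<lambda>x. h *v x)"
      unfolding range_range_projection[of h, symmetric] by (rule rangeI)
    then show ?thesis by auto
  qed
  then obtain g where g: "\<And>i. range_projection h *v axis i 1 = h *v g i" by metis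
  have "range_projection h $ a $ i = (h ** (\<chi> b i. g i $ b)) $ a $ i" for a i
  proof -
    have "range_projection h $ a $ i = (range_projection h *v axis i 1) $ a"
      by (simp add: matrix_vector_mult_def axis_def if_distrib cong: if_cong)
    also have "\<dots> = (h ** (\<chi> b i. g i $ b)) $ a $ i"
      unfolding g by (simp add: matrix_vector_mult_def matrix_matrix_mult_def)
    finally show ?thesis .
  qed
  then have "range_projection h = h ** (\<chi> b i. g i $ b)" by (simp add: vec_eq_iff)
  then show thesis by (rule that)
qed

lemma corner_iff:
  "a \<in> corner (range_projection h) \<longleftrightarrow> range_projection h ** a ** range_projection h = a"
proof
  assume "a \<in> corner (range_projection h)"
  then obtain b where "a = range_projection h ** b ** range_projection h"
    by (auto simp: corner_def)
  then show "range_projection h ** a ** range_projection h = a"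
    by (simp add: matrix_mul_assoc range_projection_idem)
      (simp add: range_projection_idem flip: matrix_mul_assoc)
next
  assume "range_projection h ** a ** range_projection h = a"
  then show "a \<in> corner (range_projection h)"
    unfolding corner_def by (intro CollectI exI[of _ a]) simp
qed

text \<open>
  Substituting the factorisation of the projection and its adjoint on the two sides of
  \<open>a = p a p\<close> exhibits \<open>a\<close> as a form in the vector \<open>h x\<close>: \<open>x \<bullet> a x = (h x) \<bullet> w (h x)\<close>. In this
  shape it can be compared with \<open>|h x|\<^sup>2\<close>.
\<close>

lemma corner_factor:
  assumes "ctranspose h = h" "a \<in> corner (range_projection h)"
  obtains w where "a = h ** w ** h"
proof -
  obtain k where k: "range_projection h = h ** k"
    using range_projection_factor by blast
  then have k': "range_projection h = ctranspose k ** h"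
    using ctranspose_range_projection[of h] assms(1) by (metis ctranspose_mult)
  have "a = range_projection h ** a ** range_projection h"
    using assms(2) by (simp add: corner_iff)
  also have "\<dots> = (h ** k) ** a ** (ctranspose k ** h)"
    using k k' by metis
  also have "\<dots> = h ** (k ** a ** ctranspose k) ** h"
    by (simp add: matrix_mul_assoc)
  finally show thesis by (rule that)
qed

lemma corner_add: "a \<in> corner p \<Longrightarrow> b \<in> corner p \<Longrightarrow> a + b \<in> corner p"
proof -
  have "p ** x ** p + p ** y ** p = p ** (x + y) ** p" for x y
    by (simp add: matrix_matrix_mult_def vec_eq_iff sum.distrib algebra_simps)
  then show "a \<in> corner p \<Longrightarrow> b \<in> corner p \<Longrightarrow> a + b \<in> corner p"
    unfolding corner_def by blast
qed

lemma corner_cscale: "a \<in> corner p \<Longrightarrow> cscale c a \<in> corner p"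
proof -
  have "cscale c (p ** x ** p) = p ** cscale c x ** p" for x
    by (simp add: cscale_mult_left cscale_mult_right)
  then show "a \<in> corner p \<Longrightarrow> cscale c a \<in> corner p"
    unfolding corner_def by blast
qed

lemma corner_ctranspose:
  assumes "a \<in> corner (range_projection h)"
  shows "ctranspose a \<in> corner (range_projection h)"
proof -
  let ?p = "range_projection h"
  have "?p ** ctranspose a ** ?p = ctranspose (?p ** a ** ?p)"
    by (simp add: ctranspose_mult ctranspose_range_projection matrix_mul_assoc)
  then show ?thesis using assms by (simp add: corner_iff)
qed

text \<open>
  The vector \<open>x - p x\<close> is in the kernel of \<open>h\<close>, because \<open>h p = h\<close> for self-adjoint \<open>h\<close>. Hence
  \<open>a p = a\<close>, and taking adjoints \<open>p a = a\<close>.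
\<close>

lemma corner_if_mult_zero:
  assumes "ctranspose h = h" "ctranspose a = a" and ker: "\<And>x. h *v x = 0 \<Longrightarrow> a *v x = 0"
  shows "a \<in> corner (range_projection h)"
proof -
  let ?p = "range_projection h"
  have "a *v x = a *v (?p *v x)" for x
  proof -
    have "h *v (x - ?p *v x) = 0"
      by (simp add: linear_diff matrix_vector_mul_assoc mult_range_projection[OF assms(1)])
    from ker[OF this] show ?thesis by (simp add: linear_diff)
  qed
  then have "a ** ?p = a" by (simp add: matrix_eq matrix_vector_mul_assoc)
  moreover from this have "?p ** a = a"
    by (metis assms(2) ctranspose_mult ctranspose_range_projection)
  ultimately show ?thesis by (simp add: corner_iff)
qed

text \<open>
  Writing \<open>v = h w h\<close>, the form of \<open>v\<close> at \<open>x\<close> is at most a multiple of \<open>|h x|\<^sup>2\<close>, hence at most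
  a multiple of \<open>x \<bullet> h x\<close>; a small enough \<open>e\<close> makes the multiple at most one.
\<close>

lemma positive_matrix_perturb:
  assumes h: "positive_matrix h" and v: "ctranspose v = v" "v \<in> corner (range_projection h)"
  obtains e where "e > 0" "positive_matrix (h + e *\<^sub>R v)" "positive_matrix (h - e *\<^sub>R v)"
proof -
  have hh: "ctranspose h = h" using h by (simp add: positive_matrix_iff)
  obtain w where w: "v = h ** w ** h" using corner_factor[OF hh v(2)] by blast
  obtain K where K: "K > 0" "\<And>x. norm (w *v x) \<le> norm x * K"
    using operator_bound by blast
  obtain C where C: "C > 0" "\<And>x. (norm (h *v x))\<^sup>2 \<le> C * (x \<bullet> (h *v x))"
    using positive_matrix_square_bound[OF h] by blast
  define e where "e = 1 / (K * C)"
  have e: "e > 0" using K C by (simp add: e_def)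
  have bound: "e * \<bar>x \<bullet> (v *v x)\<bar> \<le> x \<bullet> (h *v x)" for x
  proof -
    define y where "y = h *v x"
    have "x \<bullet> (v *v x) = y \<bullet> (w *v y)"
      using inner_ctranspose[of h x "w *v y"]
      by (simp add: hh w y_def flip: matrix_vector_mul_assoc)
    then have "\<bar>x \<bullet> (v *v x)\<bar> \<le> norm y * norm (w *v y)"
      by (simp add: Cauchy_Schwarz_ineq2)
    also have "\<dots> \<le> norm y * (norm y * K)"
      using K by (intro mult_left_mono) auto
    also have "\<dots> = K * (norm y)\<^sup>2" by (simp add: power2_eq_square)
    also have "\<dots> \<le> K * (C * (x \<bullet> (h *v x)))"
      using K C by (intro mult_left_mono) (auto simp: y_def)
    finally show ?thesis using K C by (simp add: e_def field_simps)
  qed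
  have "positive_matrix (h + r *\<^sub>R v)" if "\<bar>r\<bar> = e" for r
  proof -
    have "ctranspose (h + r *\<^sub>R v) = h + r *\<^sub>R v"
      by (simp add: ctranspose_add scaleR_eq_cscale ctranspose_cscale hh v)
    moreover have "0 \<le> x \<bullet> ((h + r *\<^sub>R v) *v x)" for x
    proof -
      have "\<bar>r * (x \<bullet> (v *v x))\<bar> \<le> x \<bullet> (h *v x)"
        using bound[of x] that by (simp add: abs_mult)
      then show ?thesis
        by (simp add: matrix_vector_mult_add_rdistrib scaleR_mult_vector inner_simps)
    qed
    ultimately show ?thesis by (simp add: positive_matrix_iff)
  qed
  from this[of e] this[of "- e"] e show thesis by (intro that) auto
qed

section \<open>Partial traces and marginal tracial states\<close>

text \<open>
  The normalised partial traces, that is, the two conditional expectations before tensoring with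
  the identity.
\<close>

definition ptr1 :: "'n::finite cmat2 \<Rightarrow> 'n cmat" where
  "ptr1 a = (\<chi> i k. (\<Sum>j\<in>UNIV. a $ (i, j) $ (k, j)) / of_nat CARD('n))"

definition ptr2 :: "'n::finite cmat2 \<Rightarrow> 'n cmat" where
  "ptr2 a = (\<chi> j l. (\<Sum>i\<in>UNIV. a $ (i, j) $ (i, l)) / of_nat CARD('n))"

lemma trace_ptr1_eq_trace_ptr2: "trace (ptr1 a) = trace (ptr2 a)"
  unfolding ptr1_def ptr2_def trace_def
  by (simp flip: sum_divide_distrib) (rule sum.swap)

text \<open>
  Contracting the identity \<open>x \<otimes> I + I \<otimes> y = 0\<close> over the second factor gives
  \<open>n x + T I = 0\<close>, over the first \<open>T I + n y = 0\<close>, where \<open>T\<close> is the common trace of \<open>x\<close> and \<open>y\<close>.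
  The trace of the first of these reads \<open>2 n T = 0\<close>.
\<close>

lemma V_space_iff: "a \<in> V_space \<longleftrightarrow> ptr1 a = 0 \<and> ptr2 a = 0"
proof
  assume "a \<in> V_space"
  then have "tensor (ptr1 a) (mat 1) + tensor (mat 1) (ptr2 a) = 0"
    by (simp add: V_space_def cond_exp1_def cond_exp2_def ptr1_def ptr2_def)
  then have entry: "ptr1 a $ i $ k * mat 1 $ j $ l + mat 1 $ i $ k * ptr2 a $ j $ l = 0"
    for i j k l
    by (simp add: tensor_def vec_eq_iff)
  define T where "T = trace (ptr2 a)"
  have 1: "of_nat CARD('a) * ptr1 a $ i $ k + mat 1 $ i $ k * T = 0" for i k
  proof -
    have "0 = (\<Sum>j\<in>UNIV. ptr1 a $ i $ k + mat 1 $ i $ k * ptr2 a $ j $ j)"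
      using entry[of i k j j for j] by (simp add: mat_def)
    then show ?thesis
      by (simp add: T_def trace_def sum.distrib sum_distrib_left)
  qed
  have 2: "T * mat 1 $ j $ l + of_nat CARD('a) * ptr2 a $ j $ l = 0" for j l
  proof -
    have "0 = (\<Sum>i\<in>UNIV. ptr1 a $ i $ i * mat 1 $ j $ l + ptr2 a $ j $ l)"
      using entry[of i i j l for i] by (simp add: mat_def)
    also have "\<dots> = trace (ptr1 a) * mat 1 $ j $ l + of_nat CARD('a) * ptr2 a $ j $ l"
      by (simp add: trace_def sum.distrib sum_distrib_right)
    finally show ?thesis by (simp add: T_def trace_ptr1_eq_trace_ptr2)
  qed
  have "0 = (\<Sum>i\<in>UNIV. of_nat CARD('a) * ptr1 a $ i $ i + T)"
    using 1[of i i for i] by (simp add: mat_def)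
  also have "\<dots> = of_nat CARD('a) * trace (ptr1 a) + of_nat CARD('a) * T"
    by (simp add: trace_def sum.distrib sum_distrib_left)
  finally have "T = 0" by (simp add: T_def trace_ptr1_eq_trace_ptr2)
  with 1 2 show "ptr1 a = 0 \<and> ptr2 a = 0" by (simp add: vec_eq_iff)
next
  assume *: "ptr1 a = 0 \<and> ptr2 a = 0"
  then have "cond_exp1 a = tensor 0 (mat 1)" "cond_exp2 a = tensor (mat 1) 0"
    by (simp_all add: cond_exp1_def cond_exp2_def ptr1_def ptr2_def)
  then show "a \<in> V_space"
    by (simp add: V_space_def tensor_def vec_eq_iff)
qed

text \<open>
  The partial traces are adjoint, for the trace form, to the two embeddings of the factor into the
  tensor square. This turns the marginal conditions into conditions on partial traces.
\<close>

lemma ntrace_tensor_left: "ntrace (tensor x (mat 1) ** h) = ntrace (x ** ptr1 h)"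
proof -
  have "(\<Sum>j\<in>UNIV. (tensor x (mat 1) ** h) $ (i, j) $ (i, j))
      = of_nat CARD('a) * (x ** ptr1 h) $ i $ i" for i
  proof -
    have "(tensor x (mat 1) ** h) $ (i, j) $ (i, j) = (\<Sum>k\<in>UNIV. x $ i $ k * h $ (k, j) $ (i, j))"
      for j
      by (simp add: matrix_matrix_mult_def tensor_def mat_def UNIV_Times_UNIV[symmetric]
          sum.cartesian_product' if_distrib if_distribR sum.delta cong: if_cong del: UNIV_Times_UNIV)
    then have "(\<Sum>j\<in>UNIV. (tensor x (mat 1) ** h) $ (i, j) $ (i, j))
        = (\<Sum>k\<in>UNIV. x $ i $ k * (\<Sum>j\<in>UNIV. h $ (k, j) $ (i, j)))"
      by (simp add: sum_distrib_left) (rule sum.swap)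
    then show ?thesis
      by (simp add: matrix_matrix_mult_def ptr1_def flip: sum_divide_distrib)
  qed
  then have "trace (tensor x (mat 1) ** h) = of_nat CARD('a) * trace (x ** ptr1 h)"
    by (simp add: trace_def UNIV_Times_UNIV[symmetric]
          sum.cartesian_product' sum_distrib_left del: UNIV_Times_UNIV)
  then show ?thesis by (simp add: ntrace_def)
qed

lemma ntrace_tensor_right: "ntrace (tensor (mat 1) x ** h) = ntrace (x ** ptr2 h)"
proof -
  have "(\<Sum>i\<in>UNIV. (tensor (mat 1) x ** h) $ (i, j) $ (i, j))
      = of_nat CARD('a) * (x ** ptr2 h) $ j $ j" for j
  proof -
    have "(tensor (mat 1) x ** h) $ (i, j) $ (i, j) = (\<Sum>k\<in>UNIV. x $ j $ k * h $ (i, k) $ (i, j))"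
      for i
      by (simp add: matrix_matrix_mult_def tensor_def mat_def UNIV_Times_UNIV[symmetric]
          sum.cartesian_product' if_distrib if_distribR sum.delta cong: if_cong del: UNIV_Times_UNIV)
        (subst sum.swap, simp add: if_distrib if_distribR sum.delta cong: if_cong)
    then have "(\<Sum>i\<in>UNIV. (tensor (mat 1) x ** h) $ (i, j) $ (i, j))
        = (\<Sum>k\<in>UNIV. x $ j $ k * (\<Sum>i\<in>UNIV. h $ (i, k) $ (i, j)))"
      by (simp add: sum_distrib_left) (rule sum.swap)
    then show ?thesis
      by (simp add: matrix_matrix_mult_def ptr2_def flip: sum_divide_distrib)
  qed
  note * = this
  have "trace (tensor (mat 1) x ** h) = of_nat CARD('a) * trace (x ** ptr2 h)"
    unfolding trace_def sum_distrib_left *[symmetric]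
    by (simp add: UNIV_Times_UNIV[symmetric] sum.cartesian_product' del: UNIV_Times_UNIV)
      (subst sum.swap, simp)
  then show ?thesis by (simp add: ntrace_def)
qed

text \<open>
  Nondegeneracy of the trace form, by testing against matrix units.
\<close>

lemma ntrace_mult_eq_iff:
  "(\<forall>x. ntrace (x ** y) = ntrace x) \<longleftrightarrow> y = mat 1" for y :: "'n::finite cmat"
proof
  assume *: "\<forall>x. ntrace (x ** y) = ntrace x"
  have "y $ i $ j = mat 1 $ i $ j" for i j
  proof -
    \<comment> \<open>the matrix unit for which \<open>trace (x z)\<close> picks the \<open>(i, j)\<close> entry of \<open>z\<close>\<close>
    define x :: "'n cmat" where "x = (\<chi> a b. if a = j \<and> b = i then 1 else 0)"
    have "trace (x ** z) = z $ i $ j" for z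
    proof -
      have "(\<Sum>b\<in>UNIV. x $ a $ b * z $ b $ a) = (if a = j then z $ i $ a else 0)" for a
        by (cases "a = j") (simp_all add: x_def if_distrib[of "\<lambda>u. u * _"] cong: if_cong)
      then have "trace (x ** z) = (\<Sum>a\<in>UNIV. if a = j then z $ i $ a else 0)"
        by (simp add: trace_def matrix_matrix_mult_def)
      then show ?thesis by simp
    qed
    from this[of y] this[of "mat 1"] * show ?thesis by (simp add: ntrace_def)
  qed
  then show "y = mat 1" by (simp add: vec_eq_iff)
qed simp

text \<open>
  The normalisation of the trace is absorbed in the marginal condition, of which it is the instance
  at the identity; this is what makes the right-hand side purely affine apart from positivity.
\<close>

lemma marginal_tracial_iff: "marginal_tracial h \<longleftrightarrow> positive_matrix h \<and> h - mat 1 \<in> V_space"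
proof -
  have p1: "ptr1 (h - mat 1) = ptr1 h - mat 1" and p2: "ptr2 (h - mat 1) = ptr2 h - mat 1"
    by (auto simp: ptr1_def ptr2_def mat_def vec_eq_iff sum_subtractf diff_divide_distrib)
  have "marginal_tracial h \<longleftrightarrow> state_density h \<and> ptr1 h = mat 1 \<and> ptr2 h = mat 1"
    by (simp add: marginal_tracial_def ntrace_tensor_left ntrace_tensor_right
        all_conj_distrib ntrace_mult_eq_iff)
  also have "\<dots> \<longleftrightarrow> positive_matrix h \<and> ptr1 h = mat 1 \<and> ptr2 h = mat 1"
  proof -
    have "ntrace h = 1" if "ptr1 h = mat 1"
    proof -
      have "tensor (mat 1) (mat 1) = (mat 1 :: 'a cmat2)"
        by (auto simp: tensor_def mat_def vec_eq_iff prod_eq_iff)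
      then have "ntrace h = ntrace (mat 1 ** ptr1 h)"
        using ntrace_tensor_left[of "mat 1" h] by simp
      then show ?thesis using that by (simp add: ntrace_def trace_I)
    qed
    then show ?thesis by (auto simp: state_density_def)
  qed
  finally show ?thesis by (simp add: V_space_iff p1 p2)
qed

lemma V_space_add: "a \<in> V_space \<Longrightarrow> b \<in> V_space \<Longrightarrow> a + b \<in> V_space"
proof -
  have "ptr1 (a + b) = ptr1 a + ptr1 b" "ptr2 (a + b) = ptr2 a + ptr2 b"
    by (simp_all add: ptr1_def ptr2_def vec_eq_iff sum.distrib add_divide_distrib)
  then show "a \<in> V_space \<Longrightarrow> b \<in> V_space \<Longrightarrow> a + b \<in> V_space"
    by (simp add: V_space_iff)
qed

lemma V_space_cscale: "a \<in> V_space \<Longrightarrow> cscale c a \<in> V_space"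
proof -
  have "ptr1 (cscale c a) = cscale c (ptr1 a)" "ptr2 (cscale c a) = cscale c (ptr2 a)"
    by (simp_all add: ptr1_def ptr2_def cscale_def vec_eq_iff flip: sum_distrib_left)
  moreover have "cscale c 0 = (0 :: 'a cmat)"
    by (simp add: cscale_def vec_eq_iff)
  ultimately show "a \<in> V_space \<Longrightarrow> cscale c a \<in> V_space"
    by (simp add: V_space_iff)
qed

lemma V_space_diff: "a \<in> V_space \<Longrightarrow> b \<in> V_space \<Longrightarrow> a - b \<in> V_space"
  by (simp add: diff_eq_add_cscale V_space_add V_space_cscale)

lemma V_space_ctranspose: "a \<in> V_space \<Longrightarrow> ctranspose a \<in> V_space"
proof -
  have "ptr1 (ctranspose a) = ctranspose (ptr1 a)" "ptr2 (ctranspose a) = ctranspose (ptr2 a)"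
    by (simp_all add: ptr1_def ptr2_def ctranspose_def vec_eq_iff)
  moreover have "ctranspose 0 = (0 :: 'a cmat)"
    by (simp add: ctranspose_def vec_eq_iff)
  ultimately show "a \<in> V_space \<Longrightarrow> ctranspose a \<in> V_space"
    by (simp add: V_space_iff)
qed

lemma mat_1_not_in_V_space: "(mat 1 :: 'n::finite cmat2) \<notin> V_space"
proof
  assume "(mat 1 :: 'n cmat2) \<in> V_space"
  then have "ptr1 (mat 1 :: 'n cmat2) $ i $ i = 0" for i
    by (simp add: V_space_iff)
  then show False by (simp add: ptr1_def mat_def)
qed

section \<open>Extremality\<close>

text \<open>
  Both the corner and \<open>V\<close> are complex subspaces closed under adjoints, so it is enough to rule
  out nonzero self-adjoint elements \<open>u\<close>: for those, \<open>h\<close> would be the midpoint of the segment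
  from \<open>h - e u\<close> to \<open>h + e u\<close>.
\<close>

lemma extreme_imp_corner_Int_V_space:
  assumes ext: "h extreme_point_of {h :: 'n::finite cmat2. marginal_tracial h}"
    and v: "v \<in> corner (range_projection h)" "v \<in> V_space"
  shows "v = 0"
proof -
  have h: "positive_matrix h" "h - mat 1 \<in> V_space"
    using ext by (auto simp: extreme_point_of_def marginal_tracial_iff)
  have self_adjoint: "u = 0"
    if u: "ctranspose u = u" "u \<in> corner (range_projection h)" "u \<in> V_space" for u
  proof (rule ccontr)
    assume "u \<noteq> 0"
    obtain e where e: "e > 0" "positive_matrix (h + e *\<^sub>R u)" "positive_matrix (h - e *\<^sub>R u)"
      using positive_matrix_perturb[OF h(1) u(1,2)] by blast
    have eu: "e *\<^sub>R u \<in> V_space" using u(3) by (simp add: scaleR_eq_cscale V_space_cscale)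
    have "marginal_tracial (h + e *\<^sub>R u)"
      using e(2) V_space_add[OF h(2) eu] by (simp add: marginal_tracial_iff algebra_simps)
    moreover have "marginal_tracial (h - e *\<^sub>R u)"
      using e(3) V_space_diff[OF h(2) eu] by (simp add: marginal_tracial_iff algebra_simps)
    moreover have "h \<in> open_segment (h - e *\<^sub>R u) (h + e *\<^sub>R u)"
    proof -
      have "(h + e *\<^sub>R u) - (h - e *\<^sub>R u) = 2 *\<^sub>R (e *\<^sub>R u)"
        by (simp add: scaleR_2 del: scaleR_scaleR)
      moreover have "2 *\<^sub>R (e *\<^sub>R u) \<noteq> 0"
        using e(1) \<open>u \<noteq> 0\<close> by simp
      ultimately have "h - e *\<^sub>R u \<noteq> h + e *\<^sub>R u" by auto
      then have "midpoint (h - e *\<^sub>R u) (h + e *\<^sub>R u) \<in> open_segment (h - e *\<^sub>R u) (h + e *\<^sub>R u)"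
        by simp
      then show ?thesis by (simp add: midpoint_def flip: scaleR_2)
    qed
    ultimately show False using ext by (auto simp: extreme_point_of_def)
  qed
  \<comment> \<open>twice the real part of \<open>v\<close>, then minus twice its imaginary part\<close>
  have "v + ctranspose v = 0"
    using v by (intro self_adjoint)
      (simp_all add: ctranspose_add add.commute corner_add corner_ctranspose V_space_add V_space_ctranspose)
  moreover have "cscale \<i> (v + cscale (- 1) (ctranspose v)) = 0"
  proof (rule self_adjoint)
    show "ctranspose (cscale \<i> (v + cscale (- 1) (ctranspose v)))
        = cscale \<i> (v + cscale (- 1) (ctranspose v))"
      by (simp add: ctranspose_def cscale_def vec_eq_iff algebra_simps)
  qed (use v in \<open>simp_all add: corner_add corner_cscale corner_ctranspose
      V_space_add V_space_cscale V_space_ctranspose\<close>)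
  ultimately have sum: "v + ctranspose v = 0" and diff: "v = ctranspose v"
    by (simp_all add: vec_eq_iff cscale_def)
  have "v + v = 0" by (subst (2) diff) (rule sum)
  then have "2 *\<^sub>R v = 0" by (simp only: scaleR_2)
  then show ?thesis by simp
qed

text \<open>
  The end points of a segment of densities with \<open>h\<close> in its interior lie in the corner, since they vanish on the kernel of
  \<open>h\<close>, and their difference lies in \<open>V\<close>.
\<close>

lemma corner_Int_V_space_imp_extreme:
  assumes h: "marginal_tracial h" and triv: "corner (range_projection h) \<inter> V_space = {0}"
  shows "h extreme_point_of {h :: 'n::finite cmat2. marginal_tracial h}"
  unfolding extreme_point_of_def
proof (intro conjI ballI notI)
  show "h \<in> {h. marginal_tracial h}" using h by simp
next
  fix a b
  assume "a \<in> {h :: 'n cmat2. marginal_tracial h}" "b \<in> {h :: 'n cmat2. marginal_tracial h}"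
    and seg: "h \<in> open_segment a b"
  then have a: "positive_matrix a" "a - mat 1 \<in> V_space"
    and b: "positive_matrix b" "b - mat 1 \<in> V_space"
    by (auto simp: marginal_tracial_iff)
  obtain t where t: "0 < t" "t < 1" "h = (1 - t) *\<^sub>R a + t *\<^sub>R b" and "a \<noteq> b"
    using seg by (auto simp: in_segment)
  have hh: "ctranspose h = h"
    using h by (simp add: marginal_tracial_iff positive_matrix_iff)
  have "a \<in> corner (range_projection h)"
    using a(1) b(1) t hh
    by (intro corner_if_mult_zero positive_matrix_mult_zero_mono[of a b "1 - t" t h])
      (auto simp: positive_matrix_iff)
  moreover have "b \<in> corner (range_projection h)"
    using a(1) b(1) t hh
    by (intro corner_if_mult_zero positive_matrix_mult_zero_mono[of b a t "1 - t" h])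
      (auto simp: positive_matrix_iff)
  ultimately have "a - b \<in> corner (range_projection h)"
    by (simp add: diff_eq_add_cscale corner_add corner_cscale)
  moreover have "a - b \<in> V_space"
    using V_space_diff[OF a(2) b(2)] by simp
  ultimately have "a - b = 0" using triv by blast
  with \<open>a \<noteq> b\<close> show False by simp
qed

text \<open>
  As \<open>c h = c I + c (h - I)\<close> with \<open>h - I\<close> in \<open>V\<close>, two elements of \<open>\<complex> I + V\<close> with the same
  coefficient of \<open>I\<close> differ by an element of \<open>V\<close>. Conversely, \<open>V\<close> meets the line through \<open>h\<close>
  only in zero.
\<close>

lemma corner_Int_V_space_iff_line:
  assumes h: "marginal_tracial (h :: 'n::finite cmat2)"
  shows "corner (range_projection h) \<inter> V_space = {0}
    \<longleftrightarrow> corner (range_projection h) \<inter> {cscale c (mat 1) + v | c v. v \<in> V_space}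
          = {cscale c h | c. True}"
    (is "?C \<inter> V_space = {0} \<longleftrightarrow> ?C \<inter> ?A = ?L")
proof
  have hV: "h - mat 1 \<in> V_space" and hh: "ctranspose h = h"
    using h by (auto simp: marginal_tracial_iff positive_matrix_iff)
  have hC: "h \<in> ?C"
    using hh by (simp add: corner_iff range_projection_mult mult_range_projection)
  have scale_h: "cscale c h = cscale c (mat 1) + cscale c (h - mat 1)" for c
    by (simp add: cscale_def vec_eq_iff algebra_simps)
  show "?C \<inter> ?A = ?L" if triv: "?C \<inter> V_space = {0}"
  proof (intro equalityI subsetI)
    fix x assume "x \<in> ?C \<inter> ?A"
    then obtain c v where x: "x \<in> ?C" "x = cscale c (mat 1) + v" "v \<in> V_space" by blast
    have "x - cscale c h = v - cscale c (h - mat 1)"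
      by (simp add: x(2) scale_h[of c])
    then have "x - cscale c h \<in> V_space"
      using x(3) hV by (simp add: V_space_diff V_space_cscale)
    moreover have "x - cscale c h \<in> ?C"
      using x(1) hC by (simp add: diff_eq_add_cscale corner_add corner_cscale)
    ultimately have "x - cscale c h = 0" using triv by blast
    then show "x \<in> ?L" by auto
  next
    fix x assume "x \<in> ?L"
    then obtain c where c: "x = cscale c h" by blast
    then have "x \<in> ?C" using hC by (simp add: corner_cscale)
    moreover have "x \<in> ?A" using scale_h[of c] V_space_cscale[OF hV, of c] c by blast
    ultimately show "x \<in> ?C \<inter> ?A" by simp
  qed
  show "?C \<inter> V_space = {0}" if line: "?C \<inter> ?A = ?L"
  proof -
    have "v = 0" if v: "v \<in> ?C" "v \<in> V_space" for v
    proof -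
      have "v = cscale 0 (mat 1) + v" by (simp add: cscale_def vec_eq_iff)
      then have "v \<in> ?L" using line v by blast
      then obtain c where c: "v = cscale c h" by blast
      have "c = 0"
      proof (rule ccontr)
        assume "c \<noteq> 0"
        then have "h = cscale (1 / c) v" by (simp add: c cscale_def vec_eq_iff)
        then have "h \<in> V_space" using v(2) by (simp add: V_space_cscale)
        then have "mat 1 \<in> (V_space :: 'n cmat2 set)" using V_space_diff[OF _ hV] by force
        then show False using mat_1_not_in_V_space by blast
      qed
      then show ?thesis by (simp add: c cscale_def vec_eq_iff)
    qed
    moreover have "0 \<in> ?C" using corner_cscale[OF hC, of 0] by (simp add: cscale_def flip: zero_vec_def)
    moreover have "0 \<in> (V_space :: 'n cmat2 set)" using V_space_diff[OF hV hV] by simp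
    ultimately show ?thesis by blast
  qed
qed

theorem theorem2p3:
  fixes h0 :: "'n::finite cmat2"
  assumes "CARD('n) \<ge> 2"
    and "marginal_tracial h0"
  shows "(h0 extreme_point_of {h :: 'n cmat2. marginal_tracial h}
            \<longleftrightarrow> corner (range_projection h0) \<inter> V_space = {0})
       \<and> (corner (range_projection h0) \<inter> V_space = {0}
            \<longleftrightarrow> corner (range_projection h0) \<inter> {cscale c (mat 1) + v | c v. v \<in> V_space}
                  = {cscale c h0 | c. True})"
proof (intro conjI iffI)
  assume ext: "h0 extreme_point_of {h :: 'n cmat2. marginal_tracial h}"
  have "(0 :: 'n cmat2) \<in> corner (range_projection h0)"
    by (simp add: corner_iff)
  moreover have "(0 :: 'n cmat2) \<in> V_space"
    by (simp add: V_space_iff ptr1_def ptr2_def vec_eq_iff)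
  ultimately show "corner (range_projection h0) \<inter> V_space = {0}"
    using extreme_imp_corner_Int_V_space[OF ext] by blast
next
  assume "corner (range_projection h0) \<inter> V_space = {0}"
  then show "h0 extreme_point_of {h :: 'n cmat2. marginal_tracial h}"
    by (rule corner_Int_V_space_imp_extreme[OF assms(2)])
qed (simp_all only: corner_Int_V_space_iff_line[OF assms(2)])

end
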